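(* If $\Gamma \vdash \mathbb{M}:\tau$ and $\mathbb{M} \longrightarrow \mathbb{M}'$ then $\Gamma \vdash \mathbb{M}' :\tau$.
   Context: $\lambda_{\oplus}$ is the fragment of the resource calculus $\lambda^{\text{↯}}_{\oplus}$ without $\mathtt{fail}$: terms $M ::= x \mid \lambda x.M \mid M\,B \mid M\langle B/x\rangle$, bags (multisets) $B::=\mathtt{1}\mid[M]\mid B\cdot B$, expressions $\mathbb{M}$ are sums. Reduction: $(\lambda x.M)B\longrightarrow M\langle B/x\rangle$; if $\mathrm{head}(M)=x$, $B=[N_1]\cdots[N_k]$, $k\ge1$, $\#(x,M)=k$ then $M\langle B/x\rangle\longrightarrow\sum_i M\{\!|N_i/x|\!\}\langle(B\setminus N_i)/x\rangle$ (linear head substitution of $N_i$ for the head occurrence of $x$); plus closure under term contexts $[\cdot]B$, $[\cdot]\langle B/x\rangle$ and sum contexts. $\vdash$ is the non-idempotent intersection type system (strict types $\sigma::=\mathbf{unit}\mid\pi\to\sigma$, multiset types $\pi::=\bigwedge_i\sigma_i\mid\omega$) whose application and explicit-substitution rules require the bag's type $\sigma^k$ to match exactly the expected multiset type / number of occurrences, with weakening and a sum rule. *)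

theory Defs
  imports "HOL-Library.Multiset"
begin

section \<open>Syntax\<close>

text \<open>
  Terms are taken up to renaming of bound variables, represented by de Bruijn indices:
  \<open>Lam M\<close> is $\lambda x.M$ and \<open>ESub M B\<close> is the explicit substitution $M\langle B/x\rangle$.
  Both bind index \<open>0\<close> in \<open>M\<close>; the bag \<open>B\<close> lies outside the scope of \<open>x\<close>.

  Bags are finite multisets, so \<open>1\<close> is \<open>{#}\<close>, $[M]$ is \<open>{#M#}\<close> and $A \cdot B$ is \<open>A + B\<close>.
\<close>

datatype trm =
    Var nat
  | Lam trm
  | App trm "trm multiset"
  | ESub trm "trm multiset"

lemma size_bag_member [termination_simp]:
  "N \<in># B \<Longrightarrow> size N < Suc (size_multiset size B + n)" for N :: trm
  by (auto dest!: multi_member_split)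

type_synonym bag = "trm multiset"

text \<open>
  Sums are associative and commutative, but not idempotent: $M_1 + \cdots + M_n$ is the multiset of
  its summands, and a term used as an expression is a singleton.  The grammar of expressions has
  no empty sum; \<open>{#}\<close> is junk that is neither typable nor reducible nor reachable below.
\<close>

type_synonym expr = "trm multiset"

text \<open>\<open>occ x M\<close> is $\#(x,M)$, the number of free occurrences of \<open>x\<close> in \<open>M\<close>.\<close>

fun occ :: "nat \<Rightarrow> trm \<Rightarrow> nat" where
  "occ x (Var y) = (if x = y then 1 else 0)"
| "occ x (Lam M) = occ (Suc x) M"
| "occ x (App M B) = occ x M + (\<Sum>N\<in>#B. occ x N)"
| "occ x (ESub M B) = occ (Suc x) M + (\<Sum>N\<in>#B. occ x N)"

text \<open>
  \<open>head M = Some x\<close> says that the head of \<open>M\<close> is the free variable \<open>x\<close>, the index being counted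
  from outside \<open>M\<close>.  All other cases are \<open>None\<close>: the head is an abstraction, it is bound by an
  explicit substitution inside \<open>M\<close>, or \<open>M\<close> passes through a mismatched explicit substitution
  (whose head is \<open>fail\<close> in the calculus with failure).
\<close>

fun head :: "trm \<Rightarrow> nat option" where
  "head (Var x) = Some x"
| "head (Lam M) = None"
| "head (App M B) = head M"
| "head (ESub M B) =
     (if occ 0 M = size B
      then (case head M of Some (Suc x) \<Rightarrow> Some x | _ \<Rightarrow> None)
      else None)"

text \<open>\<open>lift c M\<close> makes room for a new variable with index \<open>c\<close>.\<close>

fun lift :: "nat \<Rightarrow> trm \<Rightarrow> trm" where
  "lift c (Var y) = Var (if y < c then y else Suc y)"
| "lift c (Lam M) = Lam (lift (Suc c) M)"
| "lift c (App M B) = App (lift c M) (image_mset (lift c) B)"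
| "lift c (ESub M B) = ESub (lift (Suc c) M) (image_mset (lift c) B)"

text \<open>
  Linear head substitution: \<open>hsubst x N M\<close> replaces only the head occurrence of \<open>x\<close> in \<open>M\<close>.  The
  variable \<open>x\<close> stays in scope, as other occurrences may remain.  It is meaningful only when
  \<open>head M = Some x\<close>; the equation for \<open>Lam\<close> and the \<open>else\<close> branch are outside its domain.
\<close>

fun hsubst :: "nat \<Rightarrow> trm \<Rightarrow> trm \<Rightarrow> trm" where
  "hsubst x N (Var y) = (if y = x then N else Var y)"
| "hsubst x N (Lam M) = Lam M"
| "hsubst x N (App M B) = App (hsubst x N M) B"
| "hsubst x N (ESub M B) = ESub (hsubst (Suc x) (lift 0 N) M) B"

section \<open>Reduction\<close>

text \<open>
  In \<open>fetch\<close>, the sum ranges over the elements of \<open>B\<close> with multiplicity; \<open>lift 0\<close> moves each of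
  them under the binder of the explicit substitution.
\<close>

inductive red :: "expr \<Rightarrow> expr \<Rightarrow> bool" (infix \<open>\<longrightarrow>\<^sub>\<oplus>\<close> 50) where
  beta: "{#App (Lam M) B#} \<longrightarrow>\<^sub>\<oplus> {#ESub M B#}"
| fetch: "\<lbrakk>head M = Some 0; size B \<ge> 1; occ 0 M = size B\<rbrakk> \<Longrightarrow>
    {#ESub M B#} \<longrightarrow>\<^sub>\<oplus> {#ESub (hsubst 0 (lift 0 N) M) (B - {#N#}). N \<in># B#}"
| cont_app: "{#M#} \<longrightarrow>\<^sub>\<oplus> MM \<Longrightarrow> {#App M B#} \<longrightarrow>\<^sub>\<oplus> {#App M' B. M' \<in># MM#}"
| cont_esub: "{#M#} \<longrightarrow>\<^sub>\<oplus> MM \<Longrightarrow> {#ESub M B#} \<longrightarrow>\<^sub>\<oplus> {#ESub M' B. M' \<in># MM#}"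
| cont_sum: "MM \<longrightarrow>\<^sub>\<oplus> MM' \<Longrightarrow> MM + NN \<longrightarrow>\<^sub>\<oplus> MM' + NN"

section \<open>Types\<close>

text \<open>
  The intersection is associative, commutative and non-idempotent with unit \<open>\<omega>\<close>, so multiset
  types are finite multisets of strict types: \<open>\<omega>\<close> is \<open>{#}\<close>, $\wedge$ is \<open>+\<close>, and $\sigma^k$
  is \<open>replicate_mset k \<sigma>\<close>.
\<close>

datatype sty = Unit | Arr "sty multiset" sty

type_synonym mty = "sty multiset"

text \<open>
  A context with repeated assignments $x:\sigma_1, \ldots, x:\sigma_n$ is the partial map sending
  \<open>x\<close> to $\sigma_1 \wedge \cdots \wedge \sigma_n$.  An assignment \<open>x : \<omega>\<close> (\<open>\<Gamma> x = Some {#}\<close>)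
  is distinct from \<open>x\<close> being outside the domain of \<open>\<Gamma>\<close> (\<open>\<Gamma> x = None\<close>).
\<close>

type_synonym ctx = "nat \<rightharpoonup> mty"

definition ctx_union :: "ctx \<Rightarrow> ctx \<Rightarrow> ctx" (infixl \<open>\<squnion>\<^sub>c\<close> 65) where
  "\<Gamma> \<squnion>\<^sub>c \<Delta> = (\<lambda>x. case (\<Gamma> x, \<Delta> x) of
     (Some \<pi>, Some \<zeta>) \<Rightarrow> Some (\<pi> + \<zeta>)
   | (Some \<pi>, None) \<Rightarrow> Some \<pi>
   | (None, \<zeta>) \<Rightarrow> \<zeta>)"

text \<open>\<open>\<Gamma>, x : \<pi>\<close> for a variable \<open>x\<close> outside the domain of \<open>\<Gamma>\<close> that is about to be bound.\<close>

definition ctx_bind :: "mty \<Rightarrow> ctx \<Rightarrow> ctx" where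
  "ctx_bind \<pi> \<Gamma> = case_nat (Some \<pi>) \<Gamma>"

text \<open>
  The judgement for terms is \<open>wt\<close> on singleton expressions.  Side conditions $x \notin dom(\Gamma)$
  on bound variables hold by construction, since \<open>\<Gamma>\<close> does not mention the new index \<open>0\<close>.
\<close>

inductive wt :: "ctx \<Rightarrow> expr \<Rightarrow> sty \<Rightarrow> bool"
  and wt_bag :: "ctx \<Rightarrow> bag \<Rightarrow> mty \<Rightarrow> bool" where
  var: "wt [x \<mapsto> {#\<sigma>#}] {#Var x#} \<sigma>"
| abs: "wt (ctx_bind (replicate_mset n \<sigma>) \<Gamma>) {#M#} \<tau> \<Longrightarrow>
    wt \<Gamma> {#Lam M#} (Arr (replicate_mset n \<sigma>) \<tau>)"
| app: "\<lbrakk>wt \<Gamma> {#M#} (Arr \<pi> \<tau>); wt_bag \<Delta> B \<pi>\<rbrakk> \<Longrightarrow> wt (\<Gamma> \<squnion>\<^sub>c \<Delta>) {#App M B#} \<tau>"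
| esub: "\<lbrakk>wt (ctx_bind (replicate_mset k \<sigma>) \<Gamma>) {#M#} \<tau>; wt_bag \<Delta> B (replicate_mset k \<sigma>)\<rbrakk> \<Longrightarrow>
    wt (\<Gamma> \<squnion>\<^sub>c \<Delta>) {#ESub M B#} \<tau>"
| weak: "\<lbrakk>wt \<Gamma> MM \<sigma>; x \<notin> dom \<Gamma>\<rbrakk> \<Longrightarrow> wt (\<Gamma>(x \<mapsto> {#})) MM \<sigma>"
| sum: "\<lbrakk>wt \<Gamma> MM \<sigma>; wt \<Gamma> NN \<sigma>\<rbrakk> \<Longrightarrow> wt \<Gamma> (MM + NN) \<sigma>"
| empty_bag: "wt_bag Map.empty {#} {#}"
| bag: "\<lbrakk>wt \<Gamma> {#M#} \<sigma>; wt_bag \<Delta> B (replicate_mset k \<sigma>)\<rbrakk> \<Longrightarrow>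
    wt_bag (\<Gamma> \<squnion>\<^sub>c \<Delta>) ({#M#} + B) (replicate_mset (Suc k) \<sigma>)"

end

theory Submission
  imports Defs
begin

text \<open>
  Subject reduction rests on linear head substitution: if the head of \<open>M\<close> is \<open>x\<close>, then exactly one
  of the types that the context assigns to \<open>x\<close> is consumed by the head occurrence, and a term \<open>N\<close> of
  that type can take its place, the context of \<open>N\<close> being added to the remainder.  In a \<open>fetch\<close> step
  all types of \<open>x\<close> and all types of bag elements are the same \<open>\<sigma>\<close>, so any element of the bag fits,
  and each summand is typed in the original context.
\<close>

section \<open>Algebra of contexts\<close>

lemma ctx_union_commute: "\<Gamma> \<squnion>\<^sub>c \<Delta> = \<Delta> \<squnion>\<^sub>c \<Gamma>"
  by (auto simp: ctx_union_def fun_eq_iff split: option.splits)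

lemma ctx_union_assoc: "(\<Gamma> \<squnion>\<^sub>c \<Delta>) \<squnion>\<^sub>c \<Theta> = \<Gamma> \<squnion>\<^sub>c (\<Delta> \<squnion>\<^sub>c \<Theta>)"
  by (auto simp: ctx_union_def fun_eq_iff split: option.splits)

lemma ctx_union_left_commute: "\<Gamma> \<squnion>\<^sub>c (\<Delta> \<squnion>\<^sub>c \<Theta>) = \<Delta> \<squnion>\<^sub>c (\<Gamma> \<squnion>\<^sub>c \<Theta>)"
  by (metis ctx_union_assoc ctx_union_commute)

lemmas ctx_union_ac = ctx_union_assoc ctx_union_commute ctx_union_left_commute

lemma ctx_union_None_iff [simp]: "(\<Gamma> \<squnion>\<^sub>c \<Delta>) x = None \<longleftrightarrow> \<Gamma> x = None \<and> \<Delta> x = None"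
  by (auto simp: ctx_union_def split: option.splits)

text \<open>Lets a weakening of a split context be charged to its left part when applications and
  explicit substitutions are inverted.\<close>

lemma ctx_union_upd_left:
  assumes "\<Delta> x = None"
  shows "(\<Gamma> \<squnion>\<^sub>c \<Delta>)(x \<mapsto> \<pi>) = \<Gamma>(x \<mapsto> \<pi>) \<squnion>\<^sub>c \<Delta>"
  using assms by (auto simp: ctx_union_def fun_eq_iff split: option.splits)

text \<open>The head of an application or explicit substitution lies left of the bag, so
  \<open>\<sigma>\<close> is taken from \<open>\<Gamma>\<close> and the bag's context
  \<open>\<Delta>\<close> stays intact; \<open>\<zeta>\<close> is \<open>\<pi>\<close> plus whatever
  \<open>\<Delta>\<close> assigns to \<open>x\<close>.\<close>

lemma ctx_union_upd_consumed:
  assumes "\<Gamma> x = Some (add_mset \<sigma> \<pi>)"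
  shows "\<exists>\<zeta>. (\<Gamma> \<squnion>\<^sub>c \<Delta>) x = Some (add_mset \<sigma> \<zeta>) \<and> (\<Gamma> \<squnion>\<^sub>c \<Delta>)(x \<mapsto> \<zeta>) = \<Gamma>(x \<mapsto> \<pi>) \<squnion>\<^sub>c \<Delta>"
  using assms
  by (cases "\<Delta> x") (auto simp: ctx_union_def fun_eq_iff split: option.splits)

lemma ctx_bind_upd: "ctx_bind \<pi> (\<Gamma>(x \<mapsto> \<zeta>)) = (ctx_bind \<pi> \<Gamma>)(Suc x \<mapsto> \<zeta>)"
  by (auto simp: ctx_bind_def fun_eq_iff split: nat.splits)

lemma ctx_bind_0 [simp]: "ctx_bind \<pi> \<Gamma> 0 = Some \<pi>"
  by (simp add: ctx_bind_def)

lemma ctx_bind_Suc [simp]: "ctx_bind \<pi> \<Gamma> (Suc x) = \<Gamma> x"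
  by (simp add: ctx_bind_def)

lemma ctx_bind_upd_0: "(ctx_bind \<pi> \<Gamma>)(0 \<mapsto> \<zeta>) = ctx_bind \<zeta> \<Gamma>"
  by (auto simp: ctx_bind_def fun_eq_iff split: nat.splits)

section \<open>Lifting of contexts and derivations\<close>

text \<open>The fresh index \<open>c\<close> gets \<open>None\<close>, not \<open>\<omega>\<close>,
  so that lifted contexts keep the exact form that \<open>var\<close> and \<open>empty_bag\<close>
  demand.\<close>

definition ctx_lift :: "nat \<Rightarrow> ctx \<Rightarrow> ctx" where
  "ctx_lift c \<Gamma> = (\<lambda>y. if y < c then \<Gamma> y else if y = c then None else \<Gamma> (y - 1))"

lemma ctx_lift_union: "ctx_lift c (\<Gamma> \<squnion>\<^sub>c \<Delta>) = ctx_lift c \<Gamma> \<squnion>\<^sub>c ctx_lift c \<Delta>"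
  by (auto simp: ctx_lift_def ctx_union_def fun_eq_iff)

lemma ctx_lift_empty [simp]: "ctx_lift c Map.empty = Map.empty"
  by (auto simp: ctx_lift_def)

lemma ctx_lift_upd:
  "ctx_lift c (\<Gamma>(x \<mapsto> \<pi>)) = (ctx_lift c \<Gamma>)((if x < c then x else Suc x) \<mapsto> \<pi>)"
  by (auto simp: ctx_lift_def fun_eq_iff)

lemma ctx_lift_bind: "ctx_lift (Suc c) (ctx_bind \<pi> \<Gamma>) = ctx_bind \<pi> (ctx_lift c \<Gamma>)"
  by (auto simp: ctx_lift_def ctx_bind_def fun_eq_iff split: nat.splits)

text \<open>A term moved under a binder by \<open>lift 0\<close> does not mention the bound index,
  so its context leaves the binder's type \<open>\<pi>\<close> alone.\<close>

lemma ctx_bind_union_lift: "ctx_bind \<pi> \<Gamma> \<squnion>\<^sub>c ctx_lift 0 \<Delta> = ctx_bind \<pi> (\<Gamma> \<squnion>\<^sub>c \<Delta>)"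
  by (auto simp: ctx_lift_def ctx_bind_def ctx_union_def fun_eq_iff split: nat.split option.split)

lemma wt_lift:
  "wt \<Gamma> MM \<tau> \<Longrightarrow> wt (ctx_lift c \<Gamma>) (image_mset (lift c) MM) \<tau>"
  "wt_bag \<Delta> B \<pi> \<Longrightarrow> wt_bag (ctx_lift c \<Delta>) (image_mset (lift c) B) \<pi>"
proof (induction arbitrary: c and c rule: wt_wt_bag.inducts)
  case (var x \<sigma>)
  show ?case by (simp add: ctx_lift_upd wt_wt_bag.var del: fun_upd_apply)
next
  case (abs n \<sigma> \<Gamma> M \<tau>)
  show ?case using abs.IH[of "Suc c"] by (auto simp: ctx_lift_bind intro: wt_wt_bag.abs)
next
  case (app \<Gamma> M \<pi> \<tau> \<Delta> B)
  then show ?case by (auto simp: ctx_lift_union intro: wt_wt_bag.app)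
next
  case (esub k \<sigma> \<Gamma> M \<tau> \<Delta> B)
  show ?case using esub.IH(1)[of "Suc c"] esub.IH(2)[of c]
    by (auto simp: ctx_lift_bind ctx_lift_union intro: wt_wt_bag.esub)
next
  case (weak \<Gamma> MM \<sigma> x)
  then show ?case
    unfolding ctx_lift_upd by (intro wt_wt_bag.weak) (auto simp: ctx_lift_def)
next
  case (sum \<Gamma> MM \<sigma> NN)
  then show ?case by (auto intro: wt_wt_bag.sum)
next
  case empty_bag
  then show ?case by (auto intro: wt_wt_bag.empty_bag)
next
  case (bag \<Gamma> M \<sigma> \<Delta> B k)
  show ?case using wt_wt_bag.bag[OF bag.IH(1)[of c, simplified] bag.IH(2)[of c]]
    by (simp add: ctx_lift_union)
qed

section \<open>Summands and inversion of typing\<close>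

text \<open>Both \<open>sum\<close> and \<open>weak\<close> treat all summands uniformly, so a
  derivation splits into one per summand in the same context.\<close>

lemma wt_expr_iff: "wt \<Gamma> MM \<tau> \<longleftrightarrow> MM \<noteq> {#} \<and> (\<forall>M \<in># MM. wt \<Gamma> {#M#} \<tau>)"
proof
  show "wt \<Gamma> MM \<tau> \<Longrightarrow> MM \<noteq> {#} \<and> (\<forall>M \<in># MM. wt \<Gamma> {#M#} \<tau>)"
    by (induction rule: wt_wt_bag.inducts(1)[where ?P2.0 = "\<lambda>_ _ _. True"])
      (auto intro: wt_wt_bag.intros simp del: fun_upd_apply)
  have "MM \<noteq> {#} \<Longrightarrow> \<forall>M \<in># MM. wt \<Gamma> {#M#} \<tau> \<Longrightarrow> wt \<Gamma> MM \<tau>"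
  proof (induction MM)
    case (add M MM)
    then show ?case using wt_wt_bag.sum[of \<Gamma> "{#M#}" \<tau> MM] by (cases "MM = {#}") auto
  qed simp
  then show "MM \<noteq> {#} \<and> (\<forall>M \<in># MM. wt \<Gamma> {#M#} \<tau>) \<Longrightarrow> wt \<Gamma> MM \<tau>"
    by blast
qed

text \<open>Removes the rule \<open>sum\<close> from inductions on a term: the property is proved
  for every summand of an arbitrary expression, which makes the \<open>sum\<close> case
  immediate.\<close>

lemma wt_singleton_induct [consumes 1, case_names var abs app esub weak]:
  assumes "wt \<Gamma> {#M#} \<tau>"
    and "\<And>x \<sigma>. P [x \<mapsto> {#\<sigma>#}] (Var x) \<sigma>"
    and "\<And>n \<sigma> \<Gamma> M \<tau>. wt (ctx_bind (replicate_mset n \<sigma>) \<Gamma>) {#M#} \<tau> \<Longrightarrow>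
      P (ctx_bind (replicate_mset n \<sigma>) \<Gamma>) M \<tau> \<Longrightarrow> P \<Gamma> (Lam M) (Arr (replicate_mset n \<sigma>) \<tau>)"
    and "\<And>\<Gamma> M \<pi> \<tau> \<Delta> B. wt \<Gamma> {#M#} (Arr \<pi> \<tau>) \<Longrightarrow> P \<Gamma> M (Arr \<pi> \<tau>) \<Longrightarrow>
      wt_bag \<Delta> B \<pi> \<Longrightarrow> P (\<Gamma> \<squnion>\<^sub>c \<Delta>) (App M B) \<tau>"
    and "\<And>k \<sigma> \<Gamma> M \<tau> \<Delta> B. wt (ctx_bind (replicate_mset k \<sigma>) \<Gamma>) {#M#} \<tau> \<Longrightarrow>
      P (ctx_bind (replicate_mset k \<sigma>) \<Gamma>) M \<tau> \<Longrightarrow>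
      wt_bag \<Delta> B (replicate_mset k \<sigma>) \<Longrightarrow> P (\<Gamma> \<squnion>\<^sub>c \<Delta>) (ESub M B) \<tau>"
    and "\<And>\<Gamma> M \<sigma> x. wt \<Gamma> {#M#} \<sigma> \<Longrightarrow> P \<Gamma> M \<sigma> \<Longrightarrow> \<Gamma> x = None \<Longrightarrow> P (\<Gamma>(x \<mapsto> {#})) M \<sigma>"
  shows "P \<Gamma> M \<tau>"
proof -
  have "wt \<Gamma> MM \<tau> \<Longrightarrow> \<forall>M \<in># MM. P \<Gamma> M \<tau>" for MM
  proof (induction rule: wt_wt_bag.inducts(1)[where ?P2.0 = "\<lambda>_ _ _. True"])
    case (weak \<Gamma> MM \<sigma> x)
    then show ?case using assms(6) wt_expr_iff by blast
  next
    case (var x \<sigma>)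
    show ?case by (simp add: assms(2) del: fun_upd_apply)
  next
    case (abs n \<sigma> \<Gamma> M \<tau>)
    then show ?case by (simp add: assms(3))
  next
    case (app \<Gamma> M \<pi> \<tau> \<Delta> B)
    then show ?case by (simp add: assms(4)[of _ _ \<pi>])
  next
    case (esub k \<sigma> \<Gamma> M \<tau> \<Delta> B)
    then show ?case by (simp add: assms(5)[of k \<sigma>])
  qed auto
  then show ?thesis using assms(1) by fastforce
qed

text \<open>Since \<open>weak\<close> is not syntax-directed, a derivation may end in weakenings;
  induction moves them into the premise.\<close>

lemma wt_Lam_inv:
  assumes "wt \<Gamma> {#Lam M#} \<tau>"
  obtains n \<sigma> \<rho> where "\<tau> = Arr (replicate_mset n \<sigma>) \<rho>"
    and "wt (ctx_bind (replicate_mset n \<sigma>) \<Gamma>) {#M#} \<rho>"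
proof -
  have "\<exists>n \<sigma> \<rho>. \<tau> = Arr (replicate_mset n \<sigma>) \<rho> \<and> wt (ctx_bind (replicate_mset n \<sigma>) \<Gamma>) {#M#} \<rho>"
    using assms
  proof (induction \<Gamma> "Lam M" \<tau> rule: wt_singleton_induct)
    case (weak \<Gamma> \<tau> x)
    then obtain n \<sigma> \<rho> where "\<tau> = Arr (replicate_mset n \<sigma>) \<rho>"
      and M: "wt (ctx_bind (replicate_mset n \<sigma>) \<Gamma>) {#M#} \<rho>" by blast
    moreover from weak have "wt (ctx_bind (replicate_mset n \<sigma>) (\<Gamma>(x \<mapsto> {#}))) {#M#} \<rho>"
      unfolding ctx_bind_upd by (intro wt_wt_bag.weak[OF M]) auto
    ultimately show ?case by blast
  qed auto
  then show thesis using that by blast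
qed

lemma wt_App_inv:
  assumes "wt \<Gamma> {#App M B#} \<tau>"
  obtains \<Theta> \<Delta> \<pi> where "\<Gamma> = \<Theta> \<squnion>\<^sub>c \<Delta>" "wt \<Theta> {#M#} (Arr \<pi> \<tau>)" "wt_bag \<Delta> B \<pi>"
proof -
  have "\<exists>\<Theta> \<Delta> \<pi>. \<Gamma> = \<Theta> \<squnion>\<^sub>c \<Delta> \<and> wt \<Theta> {#M#} (Arr \<pi> \<tau>) \<and> wt_bag \<Delta> B \<pi>"
    using assms
  proof (induction \<Gamma> "App M B" \<tau> rule: wt_singleton_induct)
    case (weak \<Gamma> \<sigma> x)
    then obtain \<Theta> \<Delta> \<pi> where "\<Gamma> = \<Theta> \<squnion>\<^sub>c \<Delta>" "wt \<Theta> {#M#} (Arr \<pi> \<sigma>)" "wt_bag \<Delta> B \<pi>" by blast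
    \<comment> \<open>\<open>x\<close> is outside the union, hence outside \<open>\<Theta>\<close>
      and \<open>\<Delta>\<close> alike, so the weakening can go to \<open>\<Theta>\<close>.\<close>
    moreover from this weak have "wt (\<Theta>(x \<mapsto> {#})) {#M#} (Arr \<pi> \<sigma>)"
      by (intro wt_wt_bag.weak) auto
    ultimately show ?case
      using weak by (metis ctx_union_None_iff ctx_union_upd_left)
  qed auto
  then show thesis using that by blast
qed

lemma wt_ESub_inv:
  assumes "wt \<Gamma> {#ESub M B#} \<tau>"
  obtains \<Theta> \<Delta> k \<sigma> where "\<Gamma> = \<Theta> \<squnion>\<^sub>c \<Delta>"
    and "wt (ctx_bind (replicate_mset k \<sigma>) \<Theta>) {#M#} \<tau>" "wt_bag \<Delta> B (replicate_mset k \<sigma>)"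
proof -
  have "\<exists>\<Theta> \<Delta> k \<sigma>. \<Gamma> = \<Theta> \<squnion>\<^sub>c \<Delta> \<and> wt (ctx_bind (replicate_mset k \<sigma>) \<Theta>) {#M#} \<tau> \<and>
    wt_bag \<Delta> B (replicate_mset k \<sigma>)"
    using assms
  proof (induction \<Gamma> "ESub M B" \<tau> rule: wt_singleton_induct)
    case (weak \<Gamma> \<tau> x)
    then obtain \<Theta> \<Delta> k \<sigma> where *: "\<Gamma> = \<Theta> \<squnion>\<^sub>c \<Delta>"
      "wt (ctx_bind (replicate_mset k \<sigma>) \<Theta>) {#M#} \<tau>" "wt_bag \<Delta> B (replicate_mset k \<sigma>)" by blast
    moreover from this weak have "wt (ctx_bind (replicate_mset k \<sigma>) (\<Theta>(x \<mapsto> {#}))) {#M#} \<tau>"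
      unfolding ctx_bind_upd by (intro wt_wt_bag.weak) auto
    ultimately show ?case
      using weak by (metis ctx_union_None_iff ctx_union_upd_left)
  qed auto
  then show thesis using that by blast
qed

section \<open>Bag removal and head substitution\<close>

text \<open>All elements share one type and contexts combine commutatively, so any element can be
  taken as the one added last.\<close>

lemma wt_bag_remove:
  assumes "wt_bag \<Delta> B \<pi>" "N \<in># B"
  shows "\<exists>\<Delta>\<^sub>1 \<Delta>\<^sub>2 \<sigma> j. \<Delta> = \<Delta>\<^sub>1 \<squnion>\<^sub>c \<Delta>\<^sub>2 \<and> \<pi> = replicate_mset (Suc j) \<sigma> \<and> wt \<Delta>\<^sub>1 {#N#} \<sigma> \<and>
    wt_bag \<Delta>\<^sub>2 (B - {#N#}) (replicate_mset j \<sigma>)"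
  using assms
proof (induction rule: wt_wt_bag.inducts(2)[where ?P1.0 = "\<lambda>_ _ _. True"])
  case (bag \<Gamma> M \<sigma> \<Delta> B k)
  show ?case
  proof (cases "N = M")
    case True
    then show ?thesis using bag.hyps by auto
  next
    case False
    then have "N \<in># B" using bag.prems by simp
    with bag.IH obtain \<Delta>\<^sub>1 \<Delta>\<^sub>2 \<sigma>' j where *: "\<Delta> = \<Delta>\<^sub>1 \<squnion>\<^sub>c \<Delta>\<^sub>2"
      "replicate_mset k \<sigma> = replicate_mset (Suc j) \<sigma>'" "wt \<Delta>\<^sub>1 {#N#} \<sigma>'"
      "wt_bag \<Delta>\<^sub>2 (B - {#N#}) (replicate_mset j \<sigma>')" by blast
    from *(2) have k: "k = Suc j" by (metis size_replicate_mset)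
    \<comment> \<open>The equation \<open>k = Suc j\<close> makes both multisets nonempty; empty
      ones would not determine the repeated type.\<close>
    with *(2) have \<sigma>: "\<sigma>' = \<sigma>"
      by (metis in_replicate_mset replicate_mset_Suc union_single_eq_member)
    have "wt_bag (\<Gamma> \<squnion>\<^sub>c \<Delta>\<^sub>2) ({#M#} + (B - {#N#})) (replicate_mset (Suc j) \<sigma>)"
      using wt_wt_bag.bag[OF bag.hyps(1)] *(4) \<sigma> by blast
    moreover have "{#M#} + (B - {#N#}) = {#M#} + B - {#N#}"
      using \<open>N \<in># B\<close> by simp
    moreover have "\<Gamma> \<squnion>\<^sub>c \<Delta> = \<Delta>\<^sub>1 \<squnion>\<^sub>c (\<Gamma> \<squnion>\<^sub>c \<Delta>\<^sub>2)" using *(1) by (simp add: ctx_union_ac)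
    ultimately show ?thesis using *(3) \<sigma> k by metis
  qed
qed auto

text \<open>
  The assignment for \<open>x\<close> stays in the context, possibly as \<open>x : \<omega>\<close>, even when its last
  occurrence is gone: the enclosing binder still needs it.
\<close>

lemma wt_hsubst:
  assumes "wt \<Gamma> {#M#} \<tau>" "head M = Some x"
  shows "\<exists>\<pi> \<sigma>. \<Gamma> x = Some (add_mset \<sigma> \<pi>) \<and>
    (\<forall>\<Delta> N. wt \<Delta> {#N#} \<sigma> \<longrightarrow> wt (\<Gamma>(x \<mapsto> \<pi>) \<squnion>\<^sub>c \<Delta>) {#hsubst x N M#} \<tau>)"
  using assms
proof (induction arbitrary: x rule: wt_singleton_induct)
  case (var y \<sigma>)
  have "wt ([x \<mapsto> {#}] \<squnion>\<^sub>c \<Delta>) {#N#} \<sigma>" if N: "wt \<Delta> {#N#} \<sigma>" for \<Delta> N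
  \<comment> \<open>Once its only type is consumed, \<open>x\<close> is left with
    \<open>\<omega>\<close>: weakening supplies this if \<open>\<Delta>\<close> lacks
    \<open>x\<close>, otherwise it is absorbed as the unit.\<close>
  proof (cases "\<Delta> x")
    case None
    then have "[x \<mapsto> {#}] \<squnion>\<^sub>c \<Delta> = \<Delta>(x \<mapsto> {#})"
      by (auto simp: ctx_union_def fun_eq_iff split: option.splits)
    then show ?thesis using wt_wt_bag.weak[OF N] None by auto
  next
    case (Some \<pi>)
    then have "[x \<mapsto> {#}] \<squnion>\<^sub>c \<Delta> = \<Delta>"
      by (auto simp: ctx_union_def fun_eq_iff split: option.splits)
    then show ?thesis using N by simp
  qed
  moreover have "x = y" using var by simp
  ultimately show ?case
    by (intro exI[of _ "{#}"] exI[of _ \<sigma>]) (simp del: fun_upd_apply, simp)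
next
  case (abs n \<sigma> \<Gamma> M \<tau>)
  then show ?case by simp
next
  case (app \<Gamma> M \<pi>' \<tau> \<Delta>' B)
  then obtain \<pi> \<sigma> where x: "\<Gamma> x = Some (add_mset \<sigma> \<pi>)"
    and IH: "\<And>\<Delta> N. wt \<Delta> {#N#} \<sigma> \<Longrightarrow> wt (\<Gamma>(x \<mapsto> \<pi>) \<squnion>\<^sub>c \<Delta>) {#hsubst x N M#} (Arr \<pi>' \<tau>)"
    by fastforce
  obtain \<zeta> where \<zeta>: "(\<Gamma> \<squnion>\<^sub>c \<Delta>') x = Some (add_mset \<sigma> \<zeta>)"
    "(\<Gamma> \<squnion>\<^sub>c \<Delta>')(x \<mapsto> \<zeta>) = \<Gamma>(x \<mapsto> \<pi>) \<squnion>\<^sub>c \<Delta>'"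
    using ctx_union_upd_consumed[of \<Gamma> x, OF x] by blast
  have "wt ((\<Gamma> \<squnion>\<^sub>c \<Delta>')(x \<mapsto> \<zeta>) \<squnion>\<^sub>c \<Delta>) {#hsubst x N (App M B)#} \<tau>" if "wt \<Delta> {#N#} \<sigma>" for \<Delta> N
    using wt_wt_bag.app[OF IH[OF that] app.hyps(2)] unfolding \<zeta>(2) by (simp add: ctx_union_ac)
  with \<zeta>(1) show ?case by blast
next
  case (esub k \<rho> \<Gamma> M \<tau> \<Delta>' B)
  \<comment> \<open>The head is free in the explicit substitution, so under the binder it is
    \<open>Suc x\<close>, never \<open>0\<close>.\<close>
  then have "head M = Some (Suc x)" by (auto split: if_splits option.splits nat.splits)
  with esub.IH obtain \<pi> \<sigma> where x: "\<Gamma> x = Some (add_mset \<sigma> \<pi>)"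
    and IH: "\<And>\<Delta> N. wt \<Delta> {#N#} \<sigma> \<Longrightarrow>
      wt ((ctx_bind (replicate_mset k \<rho>) \<Gamma>)(Suc x \<mapsto> \<pi>) \<squnion>\<^sub>c \<Delta>) {#hsubst (Suc x) N M#} \<tau>"
    by fastforce
  obtain \<zeta> where \<zeta>: "(\<Gamma> \<squnion>\<^sub>c \<Delta>') x = Some (add_mset \<sigma> \<zeta>)"
    "(\<Gamma> \<squnion>\<^sub>c \<Delta>')(x \<mapsto> \<zeta>) = \<Gamma>(x \<mapsto> \<pi>) \<squnion>\<^sub>c \<Delta>'"
    using ctx_union_upd_consumed[of \<Gamma> x, OF x] by blast
  have "wt ((\<Gamma> \<squnion>\<^sub>c \<Delta>')(x \<mapsto> \<zeta>) \<squnion>\<^sub>c \<Delta>) {#hsubst x N (ESub M B)#} \<tau>" if N: "wt \<Delta> {#N#} \<sigma>" for \<Delta> N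
  proof -
    have "wt (ctx_lift 0 \<Delta>) {#lift 0 N#} \<sigma>" using wt_lift(1)[OF N, of 0] by simp
    \<comment> \<open>The update at \<open>Suc x\<close> becomes one at \<open>x\<close> and the
      lifted context loses its lift, so both fit inside one \<open>ctx_bind\<close>, as
      \<open>esub\<close> demands.\<close>
    from IH[OF this]
    have "wt (ctx_bind (replicate_mset k \<rho>) (\<Gamma>(x \<mapsto> \<pi>) \<squnion>\<^sub>c \<Delta>)) {#hsubst (Suc x) (lift 0 N) M#} \<tau>"
      by (simp flip: ctx_bind_upd add: ctx_bind_union_lift)
    from wt_wt_bag.esub[OF this esub.hyps(2)] show ?thesis
      unfolding \<zeta>(2) by (simp add: ctx_union_ac)
  qed
  with \<zeta>(1) show ?case by blast
next
  case (weak \<Gamma> M \<tau> y)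
  then obtain \<pi> \<sigma> where x: "\<Gamma> x = Some (add_mset \<sigma> \<pi>)"
    and IH: "\<And>\<Delta> N. wt \<Delta> {#N#} \<sigma> \<Longrightarrow> wt (\<Gamma>(x \<mapsto> \<pi>) \<squnion>\<^sub>c \<Delta>) {#hsubst x N M#} \<tau>"
    by blast
  \<comment> \<open>\<open>\<Gamma>\<close> is defined at \<open>x\<close> but not at
    \<open>y\<close>: the variable just added by weakening cannot be the head.\<close>
  with weak.hyps have "x \<noteq> y" by auto
  have "wt (\<Gamma>(y \<mapsto> {#}, x \<mapsto> \<pi>) \<squnion>\<^sub>c \<Delta>) {#hsubst x N M#} \<tau>" if N: "wt \<Delta> {#N#} \<sigma>" for \<Delta> N
  \<comment> \<open>If \<open>\<Delta>\<close> lacks \<open>y\<close>, the weakening is redone after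
    the substitution; otherwise its \<open>\<omega>\<close> is absorbed.\<close>
  proof (cases "\<Delta> y")
    case None
    have "\<Gamma>(y \<mapsto> {#}, x \<mapsto> \<pi>) \<squnion>\<^sub>c \<Delta> = (\<Gamma>(x \<mapsto> \<pi>) \<squnion>\<^sub>c \<Delta>)(y \<mapsto> {#})"
      using None \<open>x \<noteq> y\<close> by (simp add: ctx_union_upd_left fun_upd_twist)
    then show ?thesis
      using wt_wt_bag.weak[OF IH[OF N], of y] None \<open>x \<noteq> y\<close> weak.hyps by (simp add: domIff)
  next
    case (Some \<zeta>)
    then have "\<Gamma>(y \<mapsto> {#}, x \<mapsto> \<pi>) \<squnion>\<^sub>c \<Delta> = \<Gamma>(x \<mapsto> \<pi>) \<squnion>\<^sub>c \<Delta>"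
      using \<open>x \<noteq> y\<close> weak.hyps by (auto simp: ctx_union_def fun_eq_iff split: option.splits)
    then show ?thesis using IH[OF N] by simp
  qed
  moreover have "(\<Gamma>(y \<mapsto> {#})) x = Some (add_mset \<sigma> \<pi>)" using x \<open>x \<noteq> y\<close> by simp
  ultimately show ?case by blast
qed

section \<open>Preservation of types under reduction\<close>

text \<open>Removing \<open>N\<close> and replacing the head each use up one copy of the common
  type, so bag and binder again agree on \<open>j\<close> copies; the context of \<open>N\<close>
  moves from the bag to the body.\<close>

lemma wt_fetch:
  assumes "wt \<Gamma> {#ESub M B#} \<tau>" "head M = Some 0" "N \<in># B"
  shows "wt \<Gamma> {#ESub (hsubst 0 (lift 0 N) M) (B - {#N#})#} \<tau>"
proof -
  obtain \<Theta> \<Delta> k \<sigma> where \<Gamma>: "\<Gamma> = \<Theta> \<squnion>\<^sub>c \<Delta>"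
    and M: "wt (ctx_bind (replicate_mset k \<sigma>) \<Theta>) {#M#} \<tau>"
    and B: "wt_bag \<Delta> B (replicate_mset k \<sigma>)"
    using wt_ESub_inv[OF assms(1)] .
  obtain \<Delta>\<^sub>1 \<Delta>\<^sub>2 \<sigma>' j where \<Delta>: "\<Delta> = \<Delta>\<^sub>1 \<squnion>\<^sub>c \<Delta>\<^sub>2"
    and eq: "replicate_mset k \<sigma> = replicate_mset (Suc j) \<sigma>'"
    and N: "wt \<Delta>\<^sub>1 {#N#} \<sigma>'" and B': "wt_bag \<Delta>\<^sub>2 (B - {#N#}) (replicate_mset j \<sigma>')"
    using wt_bag_remove[OF B assms(3)] by blast
  obtain \<pi> \<rho> where \<pi>: "replicate_mset (Suc j) \<sigma>' = add_mset \<rho> \<pi>"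
    and subst: "\<And>\<Delta> N. wt \<Delta> {#N#} \<rho> \<Longrightarrow> wt (ctx_bind \<pi> \<Theta> \<squnion>\<^sub>c \<Delta>) {#hsubst 0 N M#} \<tau>"
    using wt_hsubst[OF M assms(2)] unfolding eq ctx_bind_0 ctx_bind_upd_0 by blast
  \<comment> \<open>The head may consume any type assigned to \<open>0\<close>, but all of them are
    copies of \<open>\<sigma>'\<close>, the type of \<open>N\<close>.\<close>
  have \<rho>: "\<rho> = \<sigma>'" using \<pi> by (metis in_replicate_mset union_single_eq_member)
  with \<pi> have "\<pi> = replicate_mset j \<sigma>'" by simp
  moreover have "wt (ctx_lift 0 \<Delta>\<^sub>1) {#lift 0 N#} \<rho>" using wt_lift(1)[OF N, of 0] \<rho> by simp
  ultimately have
    "wt (ctx_bind (replicate_mset j \<sigma>') (\<Theta> \<squnion>\<^sub>c \<Delta>\<^sub>1)) {#hsubst 0 (lift 0 N) M#} \<tau>"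
    using subst by (metis ctx_bind_union_lift)
  from wt_wt_bag.esub[OF this B'] show ?thesis
    by (simp add: \<Gamma> \<Delta> ctx_union_ac)
qed

theorem theorem2p20:
  fixes \<Gamma> :: ctx and MM MM' :: expr and \<tau> :: sty
  assumes "wt \<Gamma> MM \<tau>"
    and "MM \<longrightarrow>\<^sub>\<oplus> MM'"
  shows "wt \<Gamma> MM' \<tau>"
  using assms(2,1)
proof (induction arbitrary: \<Gamma> \<tau>)
  case (beta M B)
  then show ?case
    \<comment> \<open>The argument type of an abstraction has the form
      \<open>replicate_mset n \<sigma>\<close>, exactly what \<open>esub\<close> asks of the
      bag.\<close>
    by (elim wt_App_inv wt_Lam_inv) (auto intro: wt_wt_bag.esub)
next
  case (fetch M B)
  then show ?case
    \<comment> \<open>The resulting sum is nonempty because \<open>size B \<ge> 1\<close>.\<close>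
    by (subst wt_expr_iff) (auto intro: wt_fetch)
next
  case (cont_app M MM B)
  from cont_app.prems obtain \<Theta> \<Delta> \<pi> where
    "\<Gamma> = \<Theta> \<squnion>\<^sub>c \<Delta>" "wt \<Theta> {#M#} (Arr \<pi> \<tau>)" and B: "wt_bag \<Delta> B \<pi>"
    by (rule wt_App_inv)
  with cont_app.IH[of \<Theta> "Arr \<pi> \<tau>"] show ?case
    \<comment> \<open>Every summand of \<open>MM\<close> is typed in the same
      \<open>\<Theta>\<close>, so the typing of \<open>B\<close> serves each copy of the
      bag.\<close>
    by (subst wt_expr_iff, subst (asm) wt_expr_iff[of _ MM]) (auto intro: wt_wt_bag.app)
next
  case (cont_esub M MM B)
  from cont_esub.prems obtain \<Theta> \<Delta> k \<sigma> where "\<Gamma> = \<Theta> \<squnion>\<^sub>c \<Delta>"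
    "wt (ctx_bind (replicate_mset k \<sigma>) \<Theta>) {#M#} \<tau>" "wt_bag \<Delta> B (replicate_mset k \<sigma>)"
    by (rule wt_ESub_inv)
  with cont_esub.IH[of "ctx_bind (replicate_mset k \<sigma>) \<Theta>" \<tau>] show ?case
    by (subst wt_expr_iff, subst (asm) wt_expr_iff[of _ MM]) (auto intro: wt_wt_bag.esub)
next
  case (cont_sum MM MM' NN)
  \<comment> \<open>No rule reduces the empty expression; an empty \<open>MM\<close> would not
    inherit a typing from \<open>MM + NN\<close>.\<close>
  from cont_sum.hyps have "MM \<noteq> {#}" by induction auto
  with cont_sum.prems have "wt \<Gamma> MM \<tau>" and NN: "\<forall>N \<in># NN. wt \<Gamma> {#N#} \<tau>"
    by (simp_all add: wt_expr_iff[of _ MM] wt_expr_iff[of _ "MM + NN"])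
  from cont_sum.IH[OF this(1)] NN show ?case
    by (subst wt_expr_iff, subst (asm) wt_expr_iff) auto
qed

end
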